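(* Let $p$ be an odd prime and $n \geq 1$ an integer. Then the minimal polynomial expression of the function $\psi_1 \colon (\mathbb{F}_p)^n \to \mathbb{F}_p$ (the $p^1$'s-place digit of the $p$-ary product of $n$ single-digit integers) is given by $$\psi_1(x_1,\dots,x_n) = x_1 \cdots x_n \left( \Psi(x_1 \cdots x_n) - \sum_{j=1}^{n} \Psi(x_j) + (n-1) \Psi(1) \right),$$ where $\Psi(t)$ is the polynomial over $\mathbb{F}_p$ defined by $$\Psi(t) = \sum_{i=1}^{p-2} \left( \frac{B_{p-1-i}}{p-1-i} \right)^{\langle p \rangle} t^i = \sum_{i=1}^{(p-3)/2} \left( \frac{B_{p-1-2i}}{p-1-2i} \right)^{\langle p \rangle} t^{2i} + \frac{p-1}{2} t^{p-2}.$$ Moreover, $$\Psi(1) = (w_p)^{\langle p \rangle} = \left( B_{p-1} + \frac{1}{p} - 1 \right)^{\langle p \rangle},$$ where $w_p = ((p-1)!+1)/p$ is Wilson's quotient.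
   Context: Let $p$ be a prime. For $a \in \mathbb{F}_p = \mathbb{Z}/p\mathbb{Z}$, let $a_{\mathbb{Z}} \in \{0,1,\dots,p-1\} \subset \mathbb{Z}$ denote the representative of the residue class $a$ in that range. For $n \geq 1$, the functions $\psi_i \colon (\mathbb{F}_p)^n \to \mathbb{F}_p$, $i = 0,1,2,\dots$, are defined by the relation in $\mathbb{Z}$ $$\prod_{j=1}^{n} (x_j)_{\mathbb{Z}} = \sum_{i \geq 0} \psi_i(x_1,\dots,x_n)_{\mathbb{Z}} \, p^i \qquad (x_1,\dots,x_n \in \mathbb{F}_p),$$ i.e. $\psi_i(x_1,\dots,x_n)_{\mathbb{Z}}$ is the $i$-th base-$p$ digit of the integer $(x_1)_{\mathbb{Z}} \cdots (x_n)_{\mathbb{Z}}$. A polynomial $\varphi \in \mathbb{F}_p[x_1,\dots,x_n]$ is a polynomial expression of a function $f \colon (\mathbb{F}_p)^n \to \mathbb{F}_p$ if $\varphi(x_1,\dots,x_n) = f(x_1,\dots,x_n)$ for all $(x_1,\dots,x_n) \in (\mathbb{F}_p)^n$. The minimal polynomial expression of $f$ is the unique polynomial expression of $f$ that has degree at most $p-1$ with respect to each variable. A function is identified with its minimal polynomial expression. For a positive integer $m$ and a rational number $a = \alpha/\beta$ with $\alpha,\beta \in \mathbb{Z}$, $\gcd(\beta,m) = 1$, define $a^{\langle m \rangle} = \alpha \cdot \beta^{-1} \in \mathbb{Z}/m\mathbb{Z}$, where $\beta^{-1}$ is the inverse of $\beta$ in $\mathbb{Z}/m\mathbb{Z}$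 (independent of the choice of the fraction). The Bernoulli numbers $B_\ell$ are taken with the convention $B_1 = -1/2$, i.e. $t/(e^t-1) = \sum_{m \geq 0} B_m t^m/m!$. An empty sum is $0$. *)

theory Defs
  imports
    "Berlekamp_Zassenhaus.Finite_Field"
    "HOL-Library.Poly_Mapping"
    "HOL-Computational_Algebra.Formal_Power_Series"
begin

text \<open>
  Throughout, \<open>p = CARD('p)\<close> with \<open>'p :: prime_card\<close>, the prime field with \<open>p\<close> elements is
  \<open>'p mod_ring\<close>, and the variables are indexed by a finite type \<open>'n\<close>, so that the number of
  variables is \<open>n = CARD('n) \<ge> 1\<close> and points of the \<open>n\<close>-dimensional space over the prime field
  are functions \<open>'n \<Rightarrow> 'p mod_ring\<close>.
\<close>

subsection \<open>Multivariate polynomials\<close>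

type_synonym ('n, 'a) mpoly = "('n \<Rightarrow>\<^sub>0 nat) \<Rightarrow>\<^sub>0 'a"

definition MConst :: "'a::zero \<Rightarrow> ('n, 'a) mpoly" where
  "MConst c = Poly_Mapping.single 0 c"

definition MVar :: "'n \<Rightarrow> ('n, 'a::zero_neq_one) mpoly" where
  "MVar j = Poly_Mapping.single (Poly_Mapping.single j 1) 1"

definition meval :: "('n::finite, 'a::comm_semiring_1) mpoly \<Rightarrow> ('n \<Rightarrow> 'a) \<Rightarrow> 'a" where
  "meval \<phi> x = (\<Sum>m\<in>Poly_Mapping.keys \<phi>. Poly_Mapping.lookup \<phi> m * (\<Prod>j\<in>UNIV. x j ^ Poly_Mapping.lookup m j))"

text \<open>Substitution of a multivariate polynomial for the variable of a univariate one.\<close>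

definition subst_poly :: "'a::comm_semiring_1 poly \<Rightarrow> ('n, 'a) mpoly \<Rightarrow> ('n, 'a) mpoly" where
  "subst_poly f \<phi> = poly (map_poly MConst f) \<phi>"

definition polynomial_expression ::
  "('n::finite, 'a::comm_semiring_1) mpoly \<Rightarrow> (('n \<Rightarrow> 'a) \<Rightarrow> 'a) \<Rightarrow> bool" where
  "polynomial_expression \<phi> f \<longleftrightarrow> (\<forall>x. meval \<phi> x = f x)"

definition max_degree_le :: "nat \<Rightarrow> ('n, 'a::zero) mpoly \<Rightarrow> bool" where
  "max_degree_le d \<phi> \<longleftrightarrow> (\<forall>m\<in>Poly_Mapping.keys \<phi>. \<forall>j. Poly_Mapping.lookup m j \<le> d)"

text \<open>Existence and uniqueness are proved in \<open>minimal_polynomial_expression_ex1\<close> below.\<close>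

definition minimal_polynomial_expression ::
  "(('n::finite \<Rightarrow> 'p::prime_card mod_ring) \<Rightarrow> 'p mod_ring) \<Rightarrow> ('n, 'p mod_ring) mpoly" where
  "minimal_polynomial_expression f =
     (THE \<phi>. polynomial_expression \<phi> f \<and> max_degree_le (CARD('p) - 1) \<phi>)"

lemma meval_superset:
  assumes "finite A" "Poly_Mapping.keys \<phi> \<subseteq> A"
  shows "meval \<phi> x = (\<Sum>m\<in>A. Poly_Mapping.lookup \<phi> m * (\<Prod>j\<in>UNIV. x j ^ Poly_Mapping.lookup m j))"
  unfolding meval_def using assms by (intro sum.mono_neutral_left) (auto simp: in_keys_iff)

lemma bij_betw_bounded_exponents:
  "bij_betw Poly_Mapping.lookup {m :: 'n::finite \<Rightarrow>\<^sub>0 nat. \<forall>j. Poly_Mapping.lookup m j \<le> d} (UNIV \<rightarrow>\<^sub>E {..d})"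
proof (rule bij_betwI')
  fix k :: "'n \<Rightarrow> nat" assume k: "k \<in> UNIV \<rightarrow>\<^sub>E {..d}"
  have "Poly_Mapping.lookup (Abs_poly_mapping k) = k"
    by (simp add: Abs_poly_mapping_inverse)
  with k show "\<exists>m\<in>{m. \<forall>j. Poly_Mapping.lookup m j \<le> d}. k = Poly_Mapping.lookup m"
    by (intro bexI[of _ "Abs_poly_mapping k"]) auto
qed (auto simp: poly_mapping_eqI)

lemma polynomial_expression_ex:
  fixes f :: "('n::finite \<Rightarrow> 'p::prime_card mod_ring) \<Rightarrow> 'p mod_ring"
  shows "\<exists>\<phi>. polynomial_expression \<phi> f \<and> max_degree_le (CARD('p) - 1) \<phi>"
proof -
  define d where "d = CARD('p) - 1"
  have p: "CARD('p) = Suc d"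
    unfolding d_def using zero_less_card_finite[where 'a = 'p] by linarith
  have d: "d > 0" using prime_card[where 'a = 'p] p by (cases d) auto
  define A where "A = {m :: 'n \<Rightarrow>\<^sub>0 nat. \<forall>j. Poly_Mapping.lookup m j \<le> d}"
  note bij = bij_betw_bounded_exponents[of d, where 'n = 'n, folded A_def]
  have finA: "finite A"
    using bij_betw_finite[OF bij] by (simp add: finite_PiE)
  define q :: "'p mod_ring \<Rightarrow> 'p mod_ring poly" where "q a = 1 - [:- a, 1:] ^ d" for a
  have deg_q: "degree (q a) \<le> d" for a
    unfolding q_def by (intro degree_diff_le) (auto intro: order.trans[OF degree_power_le])
  have fermat: "y ^ d = 1" if "y \<noteq> 0" for y :: "'p mod_ring"
    using finite_field_power_card_eq_same[of y] that by (simp add: p)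
  have q_eval: "poly (q a) y = (if y = a then 1 else 0)" for a y
    using d fermat[of "y - a"] by (auto simp: q_def)
  define c where "c m = (if m \<in> A then \<Sum>a\<in>UNIV. f a * (\<Prod>j\<in>UNIV. coeff (q (a j)) (Poly_Mapping.lookup m j)) else 0)" for m
  define \<phi> where "\<phi> = Abs_poly_mapping c"
  have c: "Poly_Mapping.lookup \<phi> = c"
    unfolding \<phi>_def
    by (rule Abs_poly_mapping_inverse) (auto simp: c_def intro: finite_subset[OF _ finA])
  have keys: "Poly_Mapping.keys \<phi> \<subseteq> A"
    by (auto simp: in_keys_iff c c_def split: if_splits)
  have "meval \<phi> x = f x" for x
  proof -
    have "meval \<phi> x = (\<Sum>m\<in>A. c m * (\<Prod>j\<in>UNIV. x j ^ Poly_Mapping.lookup m j))"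
      using meval_superset[OF finA keys] by (simp add: c)
    also have "\<dots> = (\<Sum>m\<in>A. \<Sum>a\<in>UNIV. f a * (\<Prod>j\<in>UNIV. coeff (q (a j)) (Poly_Mapping.lookup m j) * x j ^ Poly_Mapping.lookup m j))"
      by (intro sum.cong) (auto simp: c_def sum_distrib_right prod.distrib mult.assoc)
    also have "\<dots> = (\<Sum>a\<in>UNIV. f a * (\<Sum>m\<in>A. \<Prod>j\<in>UNIV. coeff (q (a j)) (Poly_Mapping.lookup m j) * x j ^ Poly_Mapping.lookup m j))"
      by (subst sum.swap) (simp add: sum_distrib_left)
    also have "\<dots> = (\<Sum>a\<in>UNIV. f a * (\<Sum>k\<in>UNIV \<rightarrow>\<^sub>E {..d}. \<Prod>j\<in>UNIV. coeff (q (a j)) (k j) * x j ^ k j))"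
      by (intro sum.cong refl arg_cong2[where f = times]
            sum.reindex_bij_betw[OF bij, of "\<lambda>k. \<Prod>j\<in>UNIV. coeff (q (_ j)) (k j) * x j ^ k j"])
    also have "\<dots> = (\<Sum>a\<in>UNIV. f a * (\<Prod>j\<in>UNIV. \<Sum>k\<le>d. coeff (q (a j)) k * x j ^ k))"
      by (subst prod_sum_PiE) auto
    also have "\<dots> = (\<Sum>a\<in>UNIV. f a * (\<Prod>j\<in>UNIV. poly (q (a j)) (x j)))"
    proof -
      have "(\<Sum>k\<le>d. coeff (q b) k * y ^ k) = poly (q b) y" for b y
        unfolding poly_altdef using deg_q[of b]
        by (intro sum.mono_neutral_right) (auto simp: coeff_eq_0)
      thus ?thesis by simp
    qed
    also have "\<dots> = (\<Sum>a\<in>UNIV. if a = x then f a else 0)"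
    proof (intro sum.cong refl)
      fix a
      show "f a * (\<Prod>j\<in>UNIV. poly (q (a j)) (x j)) = (if a = x then f a else 0)"
      proof (cases "a = x")
        case False
        then obtain j where "x j \<noteq> a j" by (metis ext)
        hence "(\<Prod>j\<in>UNIV. poly (q (a j)) (x j)) = 0"
          by (intro prod_zero) (auto simp: q_eval)
        with False show ?thesis by simp
      qed (simp add: q_eval)
    qed
    finally show ?thesis by simp
  qed
  moreover have "max_degree_le d \<phi>"
    using keys by (auto simp: max_degree_le_def A_def)
  ultimately show ?thesis
    unfolding polynomial_expression_def d_def by blast
qed

lemma minimal_polynomial_expression_ex1:
  fixes f :: "('n::finite \<Rightarrow> 'p::prime_card mod_ring) \<Rightarrow> 'p mod_ring"
  shows "\<exists>!\<phi>. polynomial_expression \<phi> f \<and> max_degree_le (CARD('p) - 1) \<phi>"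
proof -
  define d where "d = CARD('p) - 1"
  have p: "CARD('p) = Suc d"
    unfolding d_def using zero_less_card_finite[where 'a = 'p] by linarith
  define A where "A = {m :: 'n \<Rightarrow>\<^sub>0 nat. \<forall>j. Poly_Mapping.lookup m j \<le> d}"
  note bij = bij_betw_bounded_exponents[of d, where 'n = 'n, folded A_def]
  have finA: "finite A"
    using bij_betw_finite[OF bij] by (simp add: finite_PiE)
  have cardA: "card A = CARD('p) ^ CARD('n)"
    using bij_betw_same_card[OF bij] by (simp add: card_PiE p)
  define R where "R = {\<phi> :: ('n, 'p mod_ring) mpoly. max_degree_le d \<phi>}"
  have keysR: "Poly_Mapping.lookup \<phi> m = 0" if "\<phi> \<in> R" "m \<notin> A" for \<phi> m
    using that by (auto simp: R_def A_def max_degree_le_def in_keys_iff)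
  define r where "r \<phi> = restrict (Poly_Mapping.lookup \<phi>) A" for \<phi> :: "('n, 'p mod_ring) mpoly"
  have inj: "inj_on r R"
  proof (rule inj_onI)
    fix \<phi> \<chi> assume *: "\<phi> \<in> R" "\<chi> \<in> R" "r \<phi> = r \<chi>"
    have "Poly_Mapping.lookup \<phi> m = Poly_Mapping.lookup \<chi> m" for m
      using keysR[OF *(1), of m] keysR[OF *(2), of m] fun_cong[OF *(3), of m]
      by (cases "m \<in> A") (auto simp: r_def)
    thus "\<phi> = \<chi>" by (intro poly_mapping_eqI)
  qed
  have sub: "r ` R \<subseteq> A \<rightarrow>\<^sub>E UNIV" by (auto simp: r_def)
  have fin: "finite (A \<rightarrow>\<^sub>E (UNIV :: 'p mod_ring set))" using finA by (simp add: finite_PiE)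
  have finR: "finite R" using finite_imageD[OF finite_subset[OF sub fin] inj] .
  have "card R \<le> card (A \<rightarrow>\<^sub>E (UNIV :: 'p mod_ring set))"
    by (rule card_inj_on_le[OF inj sub fin])
  also have "\<dots> = CARD(('n \<Rightarrow> 'p mod_ring) \<Rightarrow> 'p mod_ring)"
    using finA by (simp add: card_PiE card_fun cardA)
  also have "(UNIV :: (('n \<Rightarrow> 'p mod_ring) \<Rightarrow> 'p mod_ring) set) = (meval :: ('n, 'p mod_ring) mpoly \<Rightarrow> _) ` R"
  proof (rule UNIV_eq_I)
    fix g :: "('n \<Rightarrow> 'p mod_ring) \<Rightarrow> 'p mod_ring"
    obtain \<phi> where "polynomial_expression \<phi> g" "max_degree_le d \<phi>"
      using polynomial_expression_ex[of g] unfolding d_def by blast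
    thus "g \<in> meval ` R"
      by (intro image_eqI[of _ _ \<phi>]) (auto simp: R_def polynomial_expression_def)
  qed
  finally have "card R \<le> card ((meval :: ('n, 'p mod_ring) mpoly \<Rightarrow> _) ` R)" .
  hence "inj_on (meval :: ('n, 'p mod_ring) mpoly \<Rightarrow> _) R"
    using card_image_le[OF finR, of meval] by (intro eq_card_imp_inj_on finR) simp
  hence "\<phi> = \<chi>" if "polynomial_expression \<phi> f" "max_degree_le d \<phi>"
    "polynomial_expression \<chi> f" "max_degree_le d \<chi>" for \<phi> \<chi>
    using that by (elim inj_onD) (auto simp: R_def polynomial_expression_def)
  with polynomial_expression_ex[of f] show ?thesis
    unfolding d_def by blast
qed


subsection \<open>Digits of a product\<close>

definition digit_fun :: "nat \<Rightarrow> ('n::finite \<Rightarrow> 'p::prime_card mod_ring) \<Rightarrow> 'p mod_ring" where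
  "digit_fun i x = of_int ((\<Prod>j\<in>UNIV. to_int_mod_ring (x j)) div int CARD('p) ^ i mod int CARD('p))"

lemma digit_fun_sums:
  fixes x :: "'n::finite \<Rightarrow> 'p::prime_card mod_ring"
  assumes "(\<Prod>j\<in>UNIV. to_int_mod_ring (x j)) < int CARD('p) ^ N"
  shows "(\<Prod>j\<in>UNIV. to_int_mod_ring (x j)) =
    (\<Sum>i<N. to_int_mod_ring (digit_fun i x) * int CARD('p) ^ i)"
proof -
  define p where "p = int CARD('p)"
  have p: "p > 0" by (simp add: p_def)
  have nonneg: "to_int_mod_ring y \<ge> 0" for y :: "'p mod_ring"
    using range_to_int_mod_ring[where 'a = 'p] by (metis atLeastLessThan_iff rangeI)
  define P where "P = (\<Prod>j\<in>UNIV. to_int_mod_ring (x j))"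
  have P: "P \<ge> 0" unfolding P_def by (intro prod_nonneg) (simp add: nonneg)
  have dig: "to_int_mod_ring (digit_fun i x) = P div p ^ i mod p" for i
    unfolding digit_fun_def P_def[symmetric] p_def of_int_of_int_mod_ring
    by (rule to_int_mod_ring_of_int_mod_ring) (use p in \<open>simp_all add: p_def\<close>)
  have "(\<Sum>i<N. P div p ^ i mod p * p ^ i) = P mod p ^ N" for N
  proof (induction N)
    case (Suc N)
    have "P mod p ^ Suc N = p ^ N * (P div p ^ N mod p) + P mod p ^ N"
      using zmod_zmult2_eq[of p P "p ^ N"] p by (simp add: mult.commute)
    with Suc show ?case by (simp add: mult.commute)
  qed simp
  moreover have "P mod p ^ N = P"
    using assms P by (simp add: P_def p_def)
  ultimately show ?thesis
    unfolding dig p_def[symmetric] P_def[symmetric] by simp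
qed


subsection \<open>Reduction of rational numbers\<close>

definition p_integral :: "nat \<Rightarrow> rat \<Rightarrow> bool" where
  "p_integral p a \<longleftrightarrow> coprime (snd (quotient_of a)) (int p)"

text \<open>Meaningful only for rationals that are integral at \<open>p = CARD('p)\<close>.\<close>

definition rat_residue :: "rat \<Rightarrow> 'p::prime_card mod_ring" where
  "rat_residue a = of_int (fst (quotient_of a)) / of_int (snd (quotient_of a))"

lemma of_int_mod_ring_eq_0_iff:
  "(of_int k :: 'p::prime_card mod_ring) = 0 \<longleftrightarrow> int CARD('p) dvd k"
  using of_int_eq_0_iff_char_dvd[where 'a = "'p mod_ring", of k] by simp

lemma rat_residue_fraction:
  assumes "coprime \<beta> (int CARD('p::prime_card))"
  shows "p_integral CARD('p) (of_int \<alpha> / of_int \<beta>)"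
    and "rat_residue (of_int \<alpha> / of_int \<beta>) = (of_int \<alpha> / of_int \<beta> :: 'p mod_ring)"
proof -
  obtain a b where ab: "quotient_of (of_int \<alpha> / of_int \<beta>) = (a, b)" by fastforce
  have b0: "b > 0" and cop: "coprime a b"
    using quotient_of_denom_pos[OF ab] quotient_of_coprime[OF ab] by auto
  have \<beta>0: "\<beta> \<noteq> 0" using assms prime_card_int[where 'a = 'p] by auto
  have "(of_int \<alpha> :: rat) / of_int \<beta> = of_int a / of_int b"
    using quotient_of_div[OF ab] by simp
  hence "(of_int (\<alpha> * b) :: rat) = of_int (a * \<beta>)"
    using b0 \<beta>0 by (simp add: field_simps)
  hence eq: "\<alpha> * b = a * \<beta>" by (simp only: of_int_eq_iff)
  hence "b dvd \<beta>" using cop by (metis coprime_commute coprime_dvd_mult_right_iff dvd_triv_right)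
  with assms have copb: "coprime b (int CARD('p))"
    by (meson coprime_divisors dvd_refl)
  thus "p_integral CARD('p) (of_int \<alpha> / of_int \<beta>)"
    by (simp add: p_integral_def ab)
  have nz: "(of_int k :: 'p mod_ring) \<noteq> 0" if "coprime k (int CARD('p))" for k
    using that prime_card_int[where 'a = 'p]
    by (metis coprime_absorb_right not_prime_unit of_int_mod_ring_eq_0_iff)
  have "(of_int \<alpha> * of_int b :: 'p mod_ring) = of_int a * of_int \<beta>"
    using arg_cong[OF eq, of "of_int :: int \<Rightarrow> 'p mod_ring"] by simp
  thus "rat_residue (of_int \<alpha> / of_int \<beta>) = (of_int \<alpha> / of_int \<beta> :: 'p mod_ring)"
    using nz[OF copb] nz[OF assms] by (simp add: rat_residue_def ab field_simps)
qed


subsection \<open>Bernoulli numbers, Wilson quotient, and the polynomial\<close>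

definition bernoulli :: "nat \<Rightarrow> rat" where
  "bernoulli m = fact m * fps_nth (fps_X / (fps_exp 1 - 1)) m"

lemma bernoulli_egf: "Abs_fps (\<lambda>m. bernoulli m / fact m) * (fps_exp 1 - 1) = fps_X"
proof -
  let ?E = "fps_exp 1 - 1 :: rat fps"
  have E0: "?E \<noteq> 0" using fps_exp_nth[of "1::rat" 1] by (auto simp: fps_eq_iff intro!: exI[of _ 1])
  have sd: "subdegree ?E = 1" by (rule subdegreeI) auto
  have "?E dvd fps_X" using E0 sd by (subst fps_dvd_iff) auto
  moreover have "Abs_fps (\<lambda>m. bernoulli m / fact m) = fps_X / ?E"
    by (simp add: fps_eq_iff bernoulli_def)
  ultimately show ?thesis by simp
qed

lemma bernoulli_0: "bernoulli 0 = 1" and bernoulli_1: "bernoulli 1 = - 1 / 2"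
proof -
  show B0: "bernoulli 0 = 1"
    using arg_cong[OF bernoulli_egf, of "\<lambda>f. fps_nth f 1"] by (simp add: fps_mult_nth)
  show "bernoulli 1 = - 1 / 2"
    using arg_cong[OF bernoulli_egf, of "\<lambda>f. fps_nth f 2"] B0
    by (simp add: fps_mult_nth numeral_2_eq_2)
qed

definition wilson_quotient :: "nat \<Rightarrow> rat" where
  "wilson_quotient p = (fact (p - 1) + 1) / of_nat p"

definition Psi :: "'p::prime_card mod_ring poly" where
  "Psi = (\<Sum>i = 1..CARD('p) - 2.
     monom (rat_residue (bernoulli (CARD('p) - 1 - i) / of_nat (CARD('p) - 1 - i))) i)"

end

theory Submission
  imports Defs "HOL-Number_Theory.Residues"
begin

text \<open>
  Write \<open>q(a) = (a\<^sup>p\<^sup>-\<^sup>1 - 1) / p\<close> for the Fermat quotient. Modulo \<open>p\<close> it is additive on products, and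
  \<open>q(r + p s) = q(r) - s / r\<close>; hence if all \<open>x\<^sub>j\<close> are nonzero, the digit \<open>\<psi>\<^sub>1\<close> equals
  \<open>X (q(X) - \<Sum>\<^sub>j q(x\<^sub>j))\<close> with \<open>X = x\<^sub>1 \<cdots> x\<^sub>n\<close>. Faulhaber's formula for \<open>\<Sum>m<a. m\<^sup>p\<^sup>-\<^sup>1\<close>, reduced
  modulo \<open>p\<close>, says that \<open>\<Psi>(a) = q(a) + c\<close> with \<open>c = B\<^sub>p\<^sub>-\<^sub>1 + 1/p - 1\<close>, and \<open>c = \<Psi>(1)\<close> because
  \<open>q(1) = 0\<close>. Summing over all nonzero \<open>a\<close> kills \<open>\<Psi>\<close>, so \<open>c\<close> is the sum of all \<open>q(a)\<close>, that is
  \<open>q((p - 1)!)\<close>, which is the Wilson quotient.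
\<close>

subsection \<open>Evaluation and degree of multivariate polynomials\<close>

lemma sum_single_lookup:
  fixes \<phi> :: "'a \<Rightarrow>\<^sub>0 'b::comm_monoid_add"
  shows "(\<Sum>m\<in>Poly_Mapping.keys \<phi>. Poly_Mapping.single m (Poly_Mapping.lookup \<phi> m)) = \<phi>"
  by (rule poly_mapping_eqI)
     (auto simp: lookup_sum lookup_single when_def in_keys_iff sum.delta)

lemma meval_single:
  "meval (Poly_Mapping.single m c) x = c * (\<Prod>j\<in>UNIV. x j ^ Poly_Mapping.lookup m j)"
  by (subst meval_superset[of "{m}"]) (auto simp: lookup_single)

lemma meval_zero [simp]: "meval 0 x = 0"
  by (simp add: meval_def)

lemma meval_add [simp]: "meval (\<phi> + \<chi>) x = meval \<phi> x + meval \<chi> x"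
proof -
  have "finite (Poly_Mapping.keys \<phi> \<union> Poly_Mapping.keys \<chi>)" by simp
  note * = meval_superset[OF this]
  show ?thesis
    using keys_add[of \<phi> \<chi>]
    by (simp add: * lookup_add distrib_right sum.distrib)
qed

lemma meval_sum [simp]: "meval (\<Sum>i\<in>I. \<phi> i) x = (\<Sum>i\<in>I. meval (\<phi> i) x)"
  by (induction I rule: infinite_finite_induct) auto

lemma meval_mult [simp]: "meval (\<phi> * \<chi>) x = meval \<phi> x * meval \<chi> x"
proof -
  define s where "s \<phi> m = Poly_Mapping.single m (Poly_Mapping.lookup \<phi> m)"
    for \<phi> :: "('b, 'a) mpoly" and m
  have s: "(\<Sum>m\<in>Poly_Mapping.keys \<phi>. s \<phi> m) = \<phi>" for \<phi>
    unfolding s_def by (rule sum_single_lookup)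
  \<comment> \<open>Both sides are bilinear in the two polynomials, so comparing them on monomials
    suffices.\<close>
  have "meval (s \<phi> k * s \<chi> l) x = meval (s \<phi> k) x * meval (s \<chi> l) x" for k l
    by (simp add: s_def mult_single meval_single lookup_add power_add prod.distrib mult_ac)
  hence "meval ((\<Sum>k\<in>Poly_Mapping.keys \<phi>. s \<phi> k) * (\<Sum>l\<in>Poly_Mapping.keys \<chi>. s \<chi> l)) x =
    meval (\<Sum>k\<in>Poly_Mapping.keys \<phi>. s \<phi> k) x * meval (\<Sum>l\<in>Poly_Mapping.keys \<chi>. s \<chi> l) x"
    by (simp add: sum_product)
  thus ?thesis by (simp add: s)
qed

lemma meval_MConst [simp]: "meval (MConst c) x = c"
  by (simp add: MConst_def meval_single)

lemma meval_MVar [simp]: "meval (MVar j) x = x j"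
proof -
  have "(\<Prod>i\<in>UNIV. x i ^ Poly_Mapping.lookup (Poly_Mapping.single j (1 :: nat)) i) =
    (\<Prod>i\<in>UNIV. if i = j then x i else 1)"
    by (intro prod.cong) (auto simp: lookup_single when_def)
  thus ?thesis by (simp add: MVar_def meval_single)
qed

lemma meval_one [simp]: "meval 1 x = 1"
  using meval_MConst[of 1 x] by (simp add: MConst_def)

lemma meval_prod [simp]: "meval (\<Prod>i\<in>I. \<phi> i) x = (\<Prod>i\<in>I. meval (\<phi> i) x)"
  by (induction I rule: infinite_finite_induct) auto

lemma meval_of_nat [simp]: "meval (of_nat k) x = of_nat k"
  by (induction k) auto

lemma meval_minus [simp]:
  fixes x :: "'n::finite \<Rightarrow> 'a::comm_ring_1"
  shows "meval (\<phi> - \<chi>) x = meval \<phi> x - meval \<chi> x"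
  using meval_add[of "\<phi> - \<chi>" \<chi> x] by (simp add: algebra_simps)

lemma subst_poly_pCons:
  "subst_poly (pCons c f) \<phi> = MConst c + \<phi> * subst_poly f \<phi>"
  by (cases "c = 0 \<and> f = 0") (auto simp: subst_poly_def MConst_def map_poly_pCons)

lemma meval_subst_poly [simp]: "meval (subst_poly f \<phi>) x = poly f (meval \<phi> x)"
proof (induction f)
  case 0
  show ?case by (simp add: subst_poly_def)
qed (simp add: subst_poly_pCons)

section \<open>Degree bounds in each variable\<close>

lemma max_degree_le_add:
  "max_degree_le d \<phi> \<Longrightarrow> max_degree_le d \<chi> \<Longrightarrow> max_degree_le d (\<phi> + \<chi>)"
  using keys_add[of \<phi> \<chi>] by (force simp: max_degree_le_def)

lemma max_degree_le_diff:
  fixes \<phi> :: "('n, 'a::ab_group_add) mpoly"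
  shows "max_degree_le d \<phi> \<Longrightarrow> max_degree_le d \<chi> \<Longrightarrow> max_degree_le d (\<phi> - \<chi>)"
  using keys_diff[of \<phi> \<chi>] by (force simp: max_degree_le_def)

lemma max_degree_le_sum:
  "(\<And>i. i \<in> I \<Longrightarrow> max_degree_le d (\<phi> i)) \<Longrightarrow> max_degree_le d (\<Sum>i\<in>I. \<phi> i)"
proof (induction I rule: infinite_finite_induct)
  case (insert i I)
  thus ?case by (simp add: max_degree_le_add)
qed (auto simp: max_degree_le_def)

lemma max_degree_le_mult:
  assumes "max_degree_le d \<phi>" "max_degree_le e \<chi>"
  shows "max_degree_le (d + e) (\<phi> * \<chi>)"
  using keys_mult[of \<phi> \<chi>] assms
  by (fastforce simp: max_degree_le_def lookup_add intro: add_mono)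

lemma max_degree_le_MConst: "max_degree_le d (MConst c)"
  by (auto simp: max_degree_le_def MConst_def)

lemma max_degree_le_of_nat: "max_degree_le d (of_nat k :: ('n, 'a::semiring_1) mpoly)"
  using max_degree_le_MConst[of d "of_nat k :: 'a", where 'a = 'n] by (simp add: MConst_def)

lemma max_degree_le_MVar: "max_degree_le 1 (MVar j :: ('n, 'a::zero_neq_one) mpoly)"
  by (auto simp: max_degree_le_def MVar_def lookup_single when_def)

text \<open>Multiplying the bounds of the factors by \<open>max_degree_le_mult\<close> would only
  give the number of variables. The variables are distinct, so the product is a single monomial with
  all exponents at most 1.\<close>

lemma max_degree_le_prod_MVar:
  "max_degree_le 1 (\<Prod>j\<in>(UNIV :: 'n::finite set). MVar j :: ('n, 'a::comm_semiring_1) mpoly)"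
proof -
  have "(\<Prod>j\<in>J. MVar j) = Poly_Mapping.single (\<Sum>j\<in>J. Poly_Mapping.single j 1) (1 :: 'a)"
    for J :: "'n set"
    by (induction J rule: infinite_finite_induct) (auto simp: MVar_def mult_single)
  moreover have "Poly_Mapping.lookup (\<Sum>j\<in>J. Poly_Mapping.single j 1) i \<le> (1 :: nat)"
    for J :: "'n set" and i
    by (auto simp: lookup_sum lookup_single when_def sum.delta)
  ultimately show ?thesis by (simp add: max_degree_le_def)
qed

text \<open>Induction along Horner's scheme: each multiplication by \<open>\<phi>\<close> raises the
  degree in every variable by at most 1.\<close>

lemma max_degree_le_subst_poly:
  assumes "max_degree_le 1 \<phi>" "degree f \<le> d"
  shows "max_degree_le d (subst_poly f \<phi>)"
  using assms(2)
proof (induction f arbitrary: d)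
  case 0
  show ?case by (simp add: subst_poly_def max_degree_le_def)
next
  case (pCons c f)
  show ?case
  proof (cases "f = 0")
    \<comment> \<open>Constants need their own case: there \<open>d\<close> may be 0, and no degree
      is left to spend on the factor \<open>\<phi>\<close>.\<close>
    case True
    thus ?thesis
      using max_degree_le_MConst[of d c] by (simp add: subst_poly_pCons) (simp add: subst_poly_def)
  next
    case False
    then obtain e where e: "d = 1 + e" "degree f \<le> e"
      using pCons.prems by (cases d) auto
    show ?thesis
      unfolding subst_poly_pCons e(1)
      by (intro max_degree_le_add max_degree_le_MConst max_degree_le_mult assms(1) pCons.IH e(2))
  qed
qed

text \<open>By uniqueness, the main formula reduces to a pointwise identity and a degree
  bound.\<close>

lemma minimal_polynomial_expression_eqI:
  fixes f :: "('n::finite \<Rightarrow> 'p::prime_card mod_ring) \<Rightarrow> 'p mod_ring"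
  assumes "\<And>x. meval \<phi> x = f x" "max_degree_le (CARD('p) - 1) \<phi>"
  shows "minimal_polynomial_expression f = \<phi>"
  unfolding minimal_polynomial_expression_def
  using assms
  by (intro the1_equality minimal_polynomial_expression_ex1) (auto simp: polynomial_expression_def)

subsection \<open>Bernoulli numbers\<close>

text \<open>With B(t) = t / (e^t - 1) one has B(-t) = B(t) + t. Comparing coefficients at an odd
  index other than 1 gives -B_m = B_m. Here \<open>C\<close> is B(-t), and the identity follows by
  cancelling e^t - 1.\<close>

lemma bernoulli_odd:
  assumes "odd m" "m \<noteq> 1"
  shows "bernoulli m = 0"
proof -
  define B where "B = Abs_fps (\<lambda>m. bernoulli m / fact m)"
  define C where "C = B oo (fps_const (- 1) * fps_X)"
  have "(B * (fps_exp 1 - 1)) oo (fps_const (- 1) * fps_X) = fps_X oo (fps_const (- 1) * fps_X)"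
    by (simp only: B_def bernoulli_egf)
  hence C: "C * (fps_exp (- 1) - 1) = - fps_X"
    by (simp add: C_def fps_compose_mult_distrib fps_compose_sub_distrib
        flip: fps_const_neg del: fps_const_neg)
  define u v :: "rat fps" where "u = fps_exp (- 1)" and "v = fps_exp 1"
  have "u * v = 1"
    unfolding u_def v_def by (simp flip: fps_exp_add_mult)
  hence "C * (v - 1) = C * (v - u * v)" by simp
  also have "\<dots> = - (C * (u - 1)) * v" by (simp add: algebra_simps)
  also have "\<dots> = fps_X * v" using C by (simp add: u_def)
  finally have "C * (fps_exp 1 - 1) = fps_X * fps_exp 1" by (simp add: v_def)
  also have "\<dots> = (B + fps_X) * (fps_exp 1 - 1)"
    using bernoulli_egf by (simp add: B_def algebra_simps)
  finally have "C * (fps_exp 1 - 1) = (B + fps_X) * (fps_exp 1 - 1)" .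
  moreover have "fps_nth (fps_exp 1 - 1 :: rat fps) 1 \<noteq> 0" by simp
  hence "fps_exp 1 - 1 \<noteq> (0 :: rat fps)" by (metis fps_zero_nth)
  ultimately have "C = B + fps_X" by simp
  from arg_cong[OF this, of "\<lambda>f. fps_nth f m"] show ?thesis
    using assms by (simp add: B_def C_def fps_compose_linear)
qed

text \<open>Faulhaber's formula: multiply the geometric sum of the series e^(mt) by t = B(t) (e^t -
  1) and compare the coefficients of t^(k+1).\<close>

lemma power_sum_bernoulli:
  "(\<Sum>m<a. of_nat m ^ k / fact k :: rat) =
    (\<Sum>j\<le>k. bernoulli j / fact j * (of_nat a ^ (k + 1 - j) / fact (k + 1 - j)))"
proof -
  define B where "B = Abs_fps (\<lambda>m. bernoulli m / fact m)"
  let ?E = "fps_exp 1 :: rat fps"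
  have "(?E - 1) * (\<Sum>m<a. ?E ^ m) = ?E ^ a - 1"
    by (simp add: power_diff_1_eq)
  hence "B * (?E - 1) * (\<Sum>m<a. fps_exp (of_nat m)) = B * (fps_exp (of_nat a) - 1)"
    by (simp add: fps_exp_power_mult mult.assoc)
  hence "fps_X * (\<Sum>m<a. fps_exp (of_nat m)) = B * (fps_exp (of_nat a) - 1)"
    by (simp add: B_def bernoulli_egf)
  from arg_cong[OF this, of "\<lambda>f. fps_nth f (Suc k)"]
  have "fps_nth (\<Sum>m<a. fps_exp (of_nat m)) k =
    (\<Sum>j\<le>Suc k. fps_nth B j * fps_nth (fps_exp (of_nat a) - 1) (Suc k - j))"
    unfolding fps_mult_nth[of B] by (simp add: atLeast0AtMost)
  \<comment> \<open>The term j = k + 1 drops out because e^(at) - 1 has no constant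
    coefficient.\<close>
  also have "\<dots> = (\<Sum>j\<le>k. bernoulli j / fact j * (of_nat a ^ (k + 1 - j) / fact (k + 1 - j)))"
    unfolding sum.atMost_Suc by (auto simp: B_def intro!: sum.cong)
  finally show ?thesis by (simp add: fps_sum_nth)
qed

subsection \<open>Rational numbers integral at a prime\<close>

lemma p_integralE:
  assumes "p_integral p a"
  obtains \<alpha> \<beta> where "a = of_int \<alpha> / of_int \<beta>" "coprime \<beta> (int p)"
  using assms quotient_of_div[of a] unfolding p_integral_def by (metis prod.collapse)

context
  fixes p :: nat
  assumes p: "p = CARD('p::prime_card)"
begin

lemma coprime_imp_of_int_neq_0:
  assumes "coprime \<beta> (int p)"
  shows "(of_int \<beta> :: 'p mod_ring) \<noteq> 0" "\<beta> \<noteq> 0"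
  using assms prime_card_int[where 'a = 'p] unfolding p of_int_mod_ring_eq_0_iff
  by (metis coprime_absorb_right not_prime_unit, use assms p prime_card_int[where 'a = 'p] in auto)

lemma p_integral_of_int: "p_integral p (of_int k)"
  and rat_residue_of_int: "rat_residue (of_int k) = (of_int k :: 'p mod_ring)"
  using rat_residue_fraction[of 1 k, where 'p = 'p] by (simp_all add: p)

text \<open>\<open>rat_residue\<close> is defined through lowest terms, but
  \<open>rat_residue_fraction\<close> evaluates it on any fraction with denominator prime to
  \<open>p\<close>. So the unreduced common denominator can be used.\<close>

lemma
  assumes "p_integral p a" "p_integral p b"
  shows p_integral_add: "p_integral p (a + b)"
    and rat_residue_add: "(rat_residue (a + b) :: 'p mod_ring) = rat_residue a + rat_residue b"
    and p_integral_mult: "p_integral p (a * b)"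
    and rat_residue_mult: "(rat_residue (a * b) :: 'p mod_ring) = rat_residue a * rat_residue b"
proof -
  obtain \<alpha> \<beta> where a: "a = of_int \<alpha> / of_int \<beta>" "coprime \<beta> (int p)"
    using assms(1) by (rule p_integralE)
  obtain \<gamma> \<delta> where b: "b = of_int \<gamma> / of_int \<delta>" "coprime \<delta> (int p)"
    using assms(2) by (rule p_integralE)
  note nz = coprime_imp_of_int_neq_0[OF a(2)] coprime_imp_of_int_neq_0[OF b(2)]
  have cop: "coprime (\<beta> * \<delta>) (int p)" using a b by simp
  have sum: "a + b = of_int (\<alpha> * \<delta> + \<gamma> * \<beta>) / of_int (\<beta> * \<delta>)"
    using nz by (simp add: a b field_simps)
  have prod: "a * b = of_int (\<alpha> * \<gamma>) / of_int (\<beta> * \<delta>)"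
    by (simp add: a b)
  note R = rat_residue_fraction[where 'p = 'p, folded p]
  show "p_integral p (a + b)" "p_integral p (a * b)"
    unfolding sum prod by (rule R(1)[OF cop])+
  show "(rat_residue (a + b) :: 'p mod_ring) = rat_residue a + rat_residue b"
    unfolding sum R(2)[OF cop] unfolding a(1) b(1) R(2)[OF a(2)] R(2)[OF b(2)]
    using nz by (simp add: add_frac_eq)
  show "(rat_residue (a * b) :: 'p mod_ring) = rat_residue a * rat_residue b"
    unfolding prod R(2)[OF cop] unfolding a(1) b(1) R(2)[OF a(2)] R(2)[OF b(2)]
    by simp
qed

lemma p_integral_uminus: "p_integral p a \<Longrightarrow> p_integral p (- a)"
  using p_integral_mult[OF p_integral_of_int[of "- 1"]] by simp

lemma p_integral_sum:
  assumes "\<And>i. i \<in> I \<Longrightarrow> p_integral p (f i)"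
  shows "p_integral p (\<Sum>i\<in>I. f i)"
  using assms p_integral_of_int[of 0]
  by (induction I rule: infinite_finite_induct) (auto intro: p_integral_add)

lemma rat_residue_sum:
  assumes "\<And>i. i \<in> I \<Longrightarrow> p_integral p (f i)"
  shows "(rat_residue (\<Sum>i\<in>I. f i) :: 'p mod_ring) = (\<Sum>i\<in>I. rat_residue (f i))"
  using assms rat_residue_of_int[of 0]
  by (induction I rule: infinite_finite_induct) (auto simp: rat_residue_add p_integral_sum)

lemma p_integral_inverse_of_nat:
  assumes "0 < k" "k < p"
  shows "p_integral p (1 / of_nat k)"
proof -
  have "coprime k p"
    using assms prime_card[where 'a = 'p] unfolding p
    by (metis coprime_commute nat_dvd_not_less prime_imp_coprime)
  thus ?thesis
    using rat_residue_fraction(1)[of "int k" 1, where 'p = 'p] by (simp add: p)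
qed

text \<open>The recursion expressing B_m through the earlier Bernoulli numbers divides only by m +
  1, which is below \<open>p\<close>.\<close>

lemma p_integral_bernoulli:
  assumes "m < p - 1"
  shows "p_integral p (bernoulli m)"
  using assms
proof (induction m rule: less_induct)
  case (less m)
  show ?case
  proof (cases "m = 0")
    case True
    thus ?thesis using p_integral_of_int[of 1] by (simp add: bernoulli_0)
  next
    case False
    \<comment> \<open>Faulhaber's formula for a = 1: the power sum is just 0^m, which is 0 for
      positive \<open>m\<close>.\<close>
    hence "0 = (\<Sum>j\<le>m. bernoulli j / fact j * (1 / fact (m + 1 - j)))"
      using power_sum_bernoulli[of m 1] by (simp add: power_0_left)
    hence "0 = fact (m + 1) * (\<Sum>j\<le>m. bernoulli j / fact j * (1 / fact (m + 1 - j)))"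
      by simp
    also have "\<dots> = (\<Sum>j\<le>m. of_nat (m + 1 choose j) * bernoulli j)"
      unfolding sum_distrib_left
      by (intro sum.cong refl) (simp add: binomial_fact field_simps)
    also have "\<dots> = of_nat (m + 1) * bernoulli m + (\<Sum>j<m. of_nat (m + 1 choose j) * bernoulli j)"
      by (simp add: lessThan_Suc_atMost[symmetric])
    finally have "bernoulli m = - (1 / of_nat (m + 1) * (\<Sum>j<m. of_nat (m + 1 choose j) * bernoulli j))"
      by (simp add: field_simps add_eq_0_iff del: of_nat_Suc)
    moreover have "p_integral p (of_nat k)" for k
      using p_integral_of_int[of "int k"] by simp
    hence "p_integral p (\<Sum>j<m. of_nat (m + 1 choose j) * bernoulli j)"
      using less by (intro p_integral_sum p_integral_mult) auto
    moreover have "p_integral p (1 / of_nat (m + 1))"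
      using less.prems by (intro p_integral_inverse_of_nat) auto
    ultimately show ?thesis
      using p_integral_uminus p_integral_mult by metis
  qed
qed

end

subsection \<open>Fermat quotients\<close>

text \<open>The argument is an integer because the residue of the quotient depends on
  \<open>a\<close> modulo p^2, not modulo \<open>p\<close>; this dependence is what detects the
  digit. The division is exact when \<open>p\<close> does not divide \<open>a\<close>.\<close>

definition fermat_quotient :: "nat \<Rightarrow> int \<Rightarrow> int" where
  "fermat_quotient p a = (a ^ (p - 1) - 1) div int p"

lemma fermat_quotient_1 [simp]: "fermat_quotient p 1 = 0"
  by (simp add: fermat_quotient_def)

text \<open>The binomial theorem to first order, for later use with \<open>h\<close> divisible by
  \<open>p\<close>. At k = 0 the truncated exponent is harmless since its coefficient is 0.\<close>

lemma power_add_mod_square: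
  fixes r h :: int
  shows "\<exists>t. (r + h) ^ k = r ^ k + of_nat k * r ^ (k - 1) * h + t * h\<^sup>2"
proof (induction k)
  case (Suc k)
  then obtain t where t: "(r + h) ^ k = r ^ k + of_nat k * r ^ (k - 1) * h + t * h\<^sup>2" ..
  have "of_nat k * r ^ (k - 1) * r = of_nat k * r ^ k"
    by (cases k) auto
  hence "(r + h) ^ Suc k = r ^ Suc k + of_nat (Suc k) * r ^ k * h
      + (of_nat k * r ^ (k - 1) + t * (r + h)) * h\<^sup>2"
    unfolding power_Suc2[of "r + h"] t by (simp add: algebra_simps power2_eq_square)
  thus ?case by auto
qed auto

context
  fixes p :: nat
  assumes p: "p = CARD('p::prime_card)"
begin

lemma prime_p: "prime p"
  using prime_card[where 'a = 'p] p by simp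

lemma of_nat_p: "(of_nat p :: 'p mod_ring) = 0"
  by (simp add: p)

lemma fermat_mod_ring:
  assumes "x \<noteq> 0"
  shows "(x :: 'p mod_ring) ^ (p - 1) = 1"
proof -
  have "p = Suc (p - 1)" using prime_gt_0_nat[OF prime_p] by simp
  hence "x * x ^ (p - 1) = x"
    using finite_field_power_card_eq_same[of x] by (metis CARD_mod_ring p power_Suc)
  thus ?thesis using assms by simp
qed

lemma fermat_quotient_eq:
  assumes "(of_int a :: 'p mod_ring) \<noteq> 0"
  shows "a ^ (p - 1) = 1 + int p * fermat_quotient p a"
proof -
  have "(of_int (a ^ (p - 1) - 1) :: 'p mod_ring) = 0"
    using fermat_mod_ring[OF assms] by simp
  hence "int p dvd a ^ (p - 1) - 1"
    unfolding of_int_mod_ring_eq_0_iff p .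
  thus ?thesis by (simp add: fermat_quotient_def)
qed

lemma fermat_quotient_eqI:
  assumes "a ^ (p - 1) = 1 + int p * q"
  shows "fermat_quotient p a = q"
  using assms prime_gt_0_nat[OF prime_p] by (simp add: fermat_quotient_def)

text \<open>In (1 + p q(a)) (1 + p q(b)) the cross term is divisible by p^2, so it contributes a
  multiple of \<open>p\<close> to the quotient.\<close>

lemma fermat_quotient_mult:
  assumes "(of_int a :: 'p mod_ring) \<noteq> 0" "(of_int b :: 'p mod_ring) \<noteq> 0"
  shows "(of_int (fermat_quotient p (a * b)) :: 'p mod_ring) =
    of_int (fermat_quotient p a) + of_int (fermat_quotient p b)"
proof -
  have "(a * b) ^ (p - 1) = 1 + int p * (fermat_quotient p a + fermat_quotient p b
      + int p * fermat_quotient p a * fermat_quotient p b)"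
    unfolding power_mult_distrib fermat_quotient_eq[OF assms(1)] fermat_quotient_eq[OF assms(2)]
    by (simp add: algebra_simps)
  from fermat_quotient_eqI[OF this] show ?thesis by (simp add: of_nat_p)
qed

lemma fermat_quotient_prod:
  assumes "\<And>i. i \<in> I \<Longrightarrow> (of_int (f i) :: 'p mod_ring) \<noteq> 0"
  shows "(of_int (fermat_quotient p (\<Prod>i\<in>I. f i)) :: 'p mod_ring) =
    (\<Sum>i\<in>I. of_int (fermat_quotient p (f i)))"
  using assms
  by (induction I rule: infinite_finite_induct) (auto simp: fermat_quotient_mult)

text \<open>The first-order term (p - 1) r^(p-2) p s is -p s / r modulo p^2. Multiplying through by
  \<open>r\<close> keeps the statement free of division.\<close>

lemma fermat_quotient_add:
  assumes "(of_int r :: 'p mod_ring) \<noteq> 0"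
  shows "(of_int r * of_int (fermat_quotient p (r + int p * s)) :: 'p mod_ring) =
    of_int r * of_int (fermat_quotient p r) - of_int s"
proof -
  obtain t where t: "(r + int p * s) ^ (p - 1) = r ^ (p - 1)
      + of_nat (p - 1) * r ^ (p - 1 - 1) * (int p * s) + t * (int p * s)\<^sup>2"
    using power_add_mod_square by blast
  have "(r + int p * s) ^ (p - 1) = 1 + int p * (fermat_quotient p r
      + of_nat (p - 1) * r ^ (p - 1 - 1) * s + int p * (t * s\<^sup>2))"
    unfolding t fermat_quotient_eq[OF assms] by (simp add: algebra_simps power2_eq_square)
  from fermat_quotient_eqI[OF this]
  have "(of_int (fermat_quotient p (r + int p * s)) :: 'p mod_ring) =
    of_int (fermat_quotient p r) - of_int r ^ (p - 1 - 1) * of_int s"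
    using prime_gt_0_nat[OF prime_p] by (simp add: of_nat_p of_nat_diff)
  moreover have "p - 1 = Suc (p - 1 - 1)"
    using prime_gt_1_nat[OF prime_p] by simp
  hence "(of_int r * of_int r ^ (p - 1 - 1) :: 'p mod_ring) = 1"
    using fermat_mod_ring[OF assms] by (metis power_Suc)
  ultimately show ?thesis
    by (simp add: right_diff_distrib flip: mult.assoc)
qed

section \<open>The digit as a difference of Fermat quotients\<close>

lemma of_int_to_int_mod_ring [simp]: "of_int (to_int_mod_ring x) = (x :: 'p mod_ring)"
  by (simp add: of_int_of_int_mod_ring)

lemma to_int_mod_ring_bounds: "0 \<le> to_int_mod_ring (x :: 'p mod_ring)" "to_int_mod_ring x < int p"
  using range_to_int_mod_ring[where 'a = 'p] unfolding p
  by (metis atLeastLessThan_iff rangeI)+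

lemma to_int_mod_ring_of_int: "to_int_mod_ring (of_int k :: 'p mod_ring) = k mod int p"
proof -
  have "int p * (k div int p) + k mod int p = k" by simp
  hence "(of_int k :: 'p mod_ring) = of_int (k mod int p)"
    using of_nat_p by (metis add_0 mult_zero_left of_int_add of_int_mult of_int_of_nat_eq)
  thus ?thesis
    using prime_gt_0_nat[OF prime_p] by (simp add: of_int_of_int_mod_ring p)
qed

lemma digit_1_eq_fermat_quotient:
  fixes x :: "'n::finite \<Rightarrow> 'p mod_ring"
  assumes "\<And>j. x j \<noteq> 0"
  shows "digit_fun 1 x = (\<Prod>j\<in>UNIV. x j) *
    (of_int (fermat_quotient p (to_int_mod_ring (\<Prod>j\<in>UNIV. x j)))
      - (\<Sum>j\<in>UNIV. of_int (fermat_quotient p (to_int_mod_ring (x j)))))"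
proof -
  define P where "P = (\<Prod>j\<in>UNIV. to_int_mod_ring (x j))"
  define r s where "r = P mod int p" and "s = P div int p"
  have P: "P = r + int p * s" by (simp add: r_def s_def)
  have X: "(\<Prod>j\<in>UNIV. x j) = of_int P" by (simp add: P_def)
  have r: "to_int_mod_ring (\<Prod>j\<in>UNIV. x j) = r"
    unfolding X to_int_mod_ring_of_int r_def ..
  have r': "of_int r = (\<Prod>j\<in>UNIV. x j)"
    unfolding r[symmetric] by simp
  \<comment> \<open>The quotient \<open>s\<close> may be \<open>p\<close> or more; the digit is
    \<open>s\<close> modulo \<open>p\<close>, and both have the same image in the field.\<close>
  have "digit_fun 1 x = of_int (to_int_mod_ring (of_int s :: 'p mod_ring))"
    unfolding to_int_mod_ring_of_int by (simp add: digit_fun_def P_def s_def p)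
  hence "digit_fun 1 x = of_int s" by simp
  moreover have "(of_int r :: 'p mod_ring) \<noteq> 0"
    using assms unfolding r' by simp
  note fermat_quotient_add[OF this, of s, folded P]
  moreover have "(of_int (fermat_quotient p P) :: 'p mod_ring) =
      (\<Sum>j\<in>UNIV. of_int (fermat_quotient p (to_int_mod_ring (x j))))"
    unfolding P_def using assms by (intro fermat_quotient_prod) simp
  ultimately show ?thesis
    unfolding r r' by (simp add: algebra_simps)
qed

section \<open>Sums over the nonzero residues\<close>

text \<open>Replacing x by g x multiplies the sum by g^i. Some nonzero g has g^i different from 1,
  since x^i - 1 has at most i < p - 1 roots.\<close>

lemma sum_power_mod_ring:
  assumes "0 < i" "i < p - 1"
  shows "(\<Sum>x\<in>- {0}. (x :: 'p mod_ring) ^ i) = 0"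
proof -
  have "\<exists>g :: 'p mod_ring. g \<noteq> 0 \<and> g ^ i \<noteq> 1"
  proof (rule ccontr)
    assume "\<not> ?thesis"
    hence "- {0} \<subseteq> {x :: 'p mod_ring. poly (monom 1 i - 1) x = 0}"
      by (auto simp: poly_monom)
    moreover have nz: "monom 1 i - 1 \<noteq> (0 :: 'p mod_ring poly)"
      using assms by (auto simp: poly_eq_iff intro!: exI[of _ i])
    ultimately have "card (- {0 :: 'p mod_ring}) \<le> card {x :: 'p mod_ring. poly (monom 1 i - 1) x = 0}"
      by (intro card_mono) auto
    also have "\<dots> \<le> degree (monom 1 i - 1 :: 'p mod_ring poly)"
      using nz by (rule poly_roots_degree)
    also have "\<dots> \<le> i"
      by (intro degree_diff_le degree_monom_le) simp
    finally show False
      using assms by (simp add: card_Diff_singleton Compl_eq_Diff_UNIV p)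
  qed
  then obtain g :: "'p mod_ring" where g: "g \<noteq> 0" "g ^ i \<noteq> 1" by blast
  have "bij_betw (\<lambda>x. g * x) (- {0}) (- {0})"
    using g(1) by (intro bij_betwI[of _ _ _ "\<lambda>x. x / g"]) auto
  from sum.reindex_bij_betw[OF this, of "\<lambda>x. x ^ i"]
  have "g ^ i * (\<Sum>x\<in>- {0}. x ^ i) = (\<Sum>x\<in>- {0}. x ^ i)"
    by (simp add: power_mult_distrib sum_distrib_left)
  thus ?thesis using g(2) by simp
qed

lemma sum_fermat_quotient_eq_wilson:
  assumes "odd p"
  obtains w where "fact (p - 1) = int p * w - 1"
    and "(\<Sum>x\<in>- {0 :: 'p mod_ring}. of_int (fermat_quotient p (to_int_mod_ring x))) =
      (of_int w :: 'p mod_ring)"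
proof -
  have "[fact (p - 1) = - 1] (mod int p)"
    using wilson_theorem[OF prime_p] .
  then obtain w where w: "fact (p - 1) = int p * w - 1"
    by (auto simp: cong_iff_dvd_diff elim!: dvdE) (metis add_diff_cancel_right')
  have "bij_betw to_int_mod_ring (- {0 :: 'p mod_ring}) {1..int (p - 1)}"
  proof (rule bij_betwI[of _ _ _ of_int])
    show "to_int_mod_ring \<in> - {0 :: 'p mod_ring} \<rightarrow> {1..int (p - 1)}"
    proof
      fix x :: "'p mod_ring" assume "x \<in> - {0}"
      hence "to_int_mod_ring x \<noteq> 0" by auto
      thus "to_int_mod_ring x \<in> {1..int (p - 1)}"
        using to_int_mod_ring_bounds[of x] unfolding atLeastAtMost_iff by linarith
    qed
    have "\<not> int p dvd k" if "k \<in> {1..int (p - 1)}" for k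
      using that by (intro zdvd_not_zless) auto
    thus "of_int \<in> {1..int (p - 1)} \<rightarrow> - {0 :: 'p mod_ring}"
      by (auto simp: of_int_mod_ring_eq_0_iff simp flip: p)
  qed (use prime_gt_0_nat[OF prime_p] in \<open>auto simp: to_int_mod_ring_of_int\<close>)
  from prod.reindex_bij_betw[OF this, of "\<lambda>k. k"]
  have "(\<Prod>x\<in>- {0 :: 'p mod_ring}. to_int_mod_ring x) = \<Prod>{1..int (p - 1)}" by simp
  also have "{1..int (p - 1)} = int ` {1..p - 1}"
    by (simp add: image_int_atLeastAtMost)
  also have "\<Prod>\<dots> = fact (p - 1)"
    by (simp add: fact_prod prod.reindex)
  finally have "(\<Prod>x\<in>- {0 :: 'p mod_ring}. to_int_mod_ring x) = - 1 + int p * w"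
    using w by simp
  hence "(\<Sum>x\<in>- {0 :: 'p mod_ring}. of_int (fermat_quotient p (to_int_mod_ring x))) =
      (of_int (fermat_quotient p (- 1 + int p * w)) :: 'p mod_ring)"
    by (subst fermat_quotient_prod[symmetric]) auto
  \<comment> \<open>As p - 1 is even, q(-1) = 0; \<open>fermat_quotient_add\<close> at r = -1 then
    leaves \<open>w\<close>.\<close>
  also have "\<dots> = of_int w"
    using fermat_quotient_add[of "- 1" w] assms by (simp add: fermat_quotient_def)
  finally show thesis using w that by blast
qed

end


subsection \<open>The polynomial and the Fermat quotient\<close>

text \<open>For q = p - 2 this is Faulhaber's formula with exponent p - 1. The two terms that can
  have \<open>p\<close> in the denominator, j = 0 and j = q + 1, are split off; in the others,
  binom(q+2, j) / (q+2) = binom(q+1, j-1) / j.\<close>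

lemma power_sum_bernoulli_Suc:
  "(\<Sum>m<a. of_nat m ^ Suc q :: rat) = of_nat a ^ (q + 2) / of_nat (q + 2) + of_nat a * bernoulli (Suc q)
    + (\<Sum>j = 1..q. of_nat ((Suc q choose (j - 1)) * a ^ (q + 2 - j)) * (bernoulli j / of_nat j))"
proof -
  define T where "T j = fact (Suc q) * (bernoulli j / fact j * (of_nat a ^ (q + 2 - j) / fact (q + 2 - j)))" for j
  have "(\<Sum>m<a. of_nat m ^ Suc q :: rat) = fact (Suc q) * (\<Sum>m<a. of_nat m ^ Suc q / fact (Suc q))"
    by (simp add: sum_divide_distrib[symmetric])
  also have "\<dots> = (\<Sum>j\<le>Suc q. T j)"
    unfolding T_def sum_distrib_left[symmetric] power_sum_bernoulli by simp
  also have "\<dots> = T 0 + T (Suc q) + (\<Sum>j = 1..q. T j)"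
    by (simp add: atMost_atLeast0 sum.atLeast_Suc_atMost[of 0 q])
  also have "T 0 = of_nat a ^ (q + 2) / of_nat (q + 2)"
    by (simp add: T_def bernoulli_0)
  also have "T (Suc q) = of_nat a * bernoulli (Suc q)"
    by (simp add: T_def)
  also have "(\<Sum>j = 1..q. T j) =
    (\<Sum>j = 1..q. of_nat ((Suc q choose (j - 1)) * a ^ (q + 2 - j)) * (bernoulli j / of_nat j))"
  proof (intro sum.cong refl)
    fix j assume "j \<in> {1..q}"
    then obtain i where i: "j = Suc i" "i < q" by (cases j) auto
    hence "(of_nat (Suc q choose i) :: rat) = fact (Suc q) / (fact i * fact (Suc q - i))"
      by (intro binomial_fact) auto
    thus "T j = of_nat ((Suc q choose (j - 1)) * a ^ (q + 2 - j)) * (bernoulli j / of_nat j)"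
      by (simp add: T_def i Suc_diff_le mult_ac)
  qed
  finally show ?thesis .
qed

context
  fixes p :: nat
  assumes p: "p = CARD('p::prime_card)"
begin

lemma p_integral_bernoulli_div:
  assumes "j \<in> {1..p - 2}"
  shows "p_integral p (bernoulli j / of_nat j)"
proof -
  have "p_integral p (bernoulli j * (1 / of_nat j))"
    using assms
    by (intro p_integral_mult[OF p] p_integral_bernoulli[OF p] p_integral_inverse_of_nat[OF p]) auto
  thus ?thesis by simp
qed

text \<open>Adjacent entries of row p - 1 of Pascal's triangle add up to an inner entry of row
  \<open>p\<close>, which \<open>p\<close> divides. Hence the signs alternate.\<close>

lemma binomial_pred_prime:
  "k < p \<Longrightarrow> (of_nat (p - 1 choose k) :: 'p mod_ring) = (- 1) ^ k"
proof (induction k)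
  case (Suc k)
  have "p = Suc (p - 1)" using Suc.prems by simp
  hence "(p choose Suc k) = (p - 1 choose k) + (p - 1 choose Suc k)"
    by (metis binomial_Suc_Suc)
  moreover have "p dvd (p choose Suc k)"
    using Suc.prems by (intro dvd_choose_prime prime_p[OF p]) auto
  hence "(of_nat (p choose Suc k) :: 'p mod_ring) = 0"
    using of_nat_p[OF p] by (metis dvd_def mult_zero_left of_nat_mult)
  ultimately have "(of_nat (p - 1 choose k) :: 'p mod_ring) + of_nat (p - 1 choose Suc k) = 0"
    by simp
  thus ?case using Suc by (simp add: add_eq_0_iff)
qed simp

text \<open>Faulhaber's formula for a = 1 has left side 0, so B_(p-1) + 1/p equals minus the
  remaining sum, whose terms are integral at \<open>p\<close>.\<close>

lemma p_integral_bernoulli_pred: "p_integral p (bernoulli (p - 1) + 1 / of_nat p - 1)"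
proof -
  define q where "q = p - 2"
  have q: "p = q + 2" using prime_ge_2_nat[OF prime_p[OF p]] by (simp add: q_def)
  have "bernoulli (p - 1) + 1 / of_nat p - 1 = - (\<Sum>j = 1..q. of_int (int (Suc q choose (j - 1))) * (bernoulli j / of_nat j))
      + of_int (- 1)"
    using power_sum_bernoulli_Suc[where a = 1 and q = q] by (simp add: q power_0_left)
  also have "p_integral p \<dots>"
    by (intro p_integral_add[OF p] p_integral_uminus[OF p] p_integral_sum[OF p]
          p_integral_mult[OF p] p_integral_of_int[OF p] p_integral_bernoulli_div) (simp add: q_def)
  finally show ?thesis .
qed

lemma rat_residue_bernoulli_1:
  assumes "odd p"
  shows "2 * rat_residue (bernoulli 1 / of_nat 1) = (- 1 :: 'p mod_ring)"
proof -
  have "coprime 2 (int p)" using assms by simp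
  from rat_residue_fraction(2)[OF this[unfolded p], of "- 1"] coprime_imp_of_int_neq_0(1)[OF p this]
  show ?thesis unfolding bernoulli_1 by simp
qed

text \<open>Faulhaber's formula at the representative \<open>a\<close> of \<open>x\<close> is first
  freed of denominators divisible by \<open>p\<close>, then reduced modulo \<open>p\<close>. The sum
  over \<open>j\<close> becomes -x \<Psi>(x) - 1, and solving for \<Psi>(x) gives the claim.\<close>

lemma poly_Psi:
  assumes "odd p" "x \<noteq> 0"
  shows "poly Psi x = of_int (fermat_quotient p (to_int_mod_ring x)) +
    (rat_residue (bernoulli (p - 1) + 1 / of_nat p - 1) :: 'p mod_ring)"
proof -
  define q where "q = p - 2"
  have q: "p = q + 2" using prime_ge_2_nat[OF prime_p[OF p]] by (simp add: q_def)
  have pq: "p - 1 = Suc q" "p - 2 = q" by (simp_all add: q)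
  define R :: "rat \<Rightarrow> 'p mod_ring" where "R = rat_residue"
  define b where "b j = bernoulli j / of_nat j" for j
  define c where "c = bernoulli (p - 1) + 1 / of_nat p - 1"
  have c: "p_integral p c"
    unfolding c_def by (rule p_integral_bernoulli_pred)
  have b: "p_integral p (b j)" if "j \<in> {1..q}" for j
    using p_integral_bernoulli_div[of j] that by (simp add: b_def q)
  define a where "a = nat (to_int_mod_ring x)"
  have a: "int a = to_int_mod_ring x"
    using to_int_mod_ring_bounds(1)[OF p, of x] by (simp add: a_def)
  have ax: "of_nat a = x"
    using of_int_to_int_mod_ring[OF p, of x] a by (metis of_int_of_nat_eq)
  have a_less: "a < p"
    using to_int_mod_ring_bounds(2)[OF p, of x] a by simp
  have a_pos: "a > 0" using ax assms(2) by (cases a) auto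
  define f where "f = fermat_quotient p (int a)"
  have "int a ^ Suc q = 1 + int p * f"
    using fermat_quotient_eq[OF p, of "int a", unfolded pq(1)] assms(2) ax by (simp add: f_def)
  hence "(of_int (int a ^ Suc q) :: rat) = of_int (1 + int p * f)" by simp
  hence "(of_nat a ^ (q + 2) / of_nat p :: rat) = of_nat a * of_int f + of_nat a / of_nat p"
    by (simp add: q field_simps)
  \<comment> \<open>The Fermat quotient turns a^p / p into a f + a / p; the part a / p joins a
    B_(p-1) to form a (c + 1). Every term is now integral at \<open>p\<close>.\<close>
  hence "of_int ((\<Sum>m<a. int m ^ Suc q) - int a * f) = of_int (int a) * (c + of_int 1)
    + (\<Sum>j = 1..q. of_int (int ((Suc q choose (j - 1)) * a ^ (p - j))) * b j)"
    using power_sum_bernoulli_Suc[where a = a and q = q]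
    by (simp add: c_def b_def q pq algebra_simps)
  moreover have int1: "p_integral p (of_int (int a) * (c + of_int 1))"
    by (intro p_integral_mult[OF p] p_integral_add[OF p] p_integral_of_int[OF p] c)
  moreover have int2: "p_integral p (of_int k * b j)" if "j \<in> {1..q}" for j k
    by (intro p_integral_mult[OF p] p_integral_of_int[OF p] b that)
  moreover have "p_integral p
      (\<Sum>j = 1..q. of_int (int ((Suc q choose (j - 1)) * a ^ (p - j))) * b j)"
    by (intro p_integral_sum[OF p] int2)
  ultimately have "R (of_int ((\<Sum>m<a. int m ^ Suc q) - int a * f)) = R (of_int (int a) * (c + of_int 1))
    + (\<Sum>j = 1..q. R (of_int (int ((Suc q choose (j - 1)) * a ^ (p - j))) * b j))"
    unfolding R_def by (simp only: rat_residue_add[OF p] rat_residue_sum[OF p])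
  also have "R (of_int (int a) * (c + of_int 1)) = x * (R c + 1)"
    unfolding R_def
      rat_residue_mult[OF p p_integral_of_int[OF p] p_integral_add[OF p c p_integral_of_int[OF p]]]
      rat_residue_add[OF p c p_integral_of_int[OF p]] rat_residue_of_int[OF p]
    by (simp add: ax)
  also have "(\<Sum>j = 1..q. R (of_int (int ((Suc q choose (j - 1)) * a ^ (p - j))) * b j)) =
      (\<Sum>j = 1..q. of_nat (Suc q choose (j - 1)) * x ^ (p - j) * R (b j))"
    unfolding R_def
    by (intro sum.cong refl, subst rat_residue_mult[OF p p_integral_of_int[OF p] b], assumption,
        subst rat_residue_of_int[OF p]) (simp add: ax)
  also have "R (of_int ((\<Sum>m<a. int m ^ Suc q) - int a * f)) = (\<Sum>m<a. of_nat m ^ Suc q) - x * of_int f"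
    unfolding R_def rat_residue_of_int[OF p] by (simp add: ax)
  finally have *: "(\<Sum>m<a. of_nat m ^ Suc q) - x * of_int f = x * (R c + 1)
    + (\<Sum>j = 1..q. of_nat (Suc q choose (j - 1)) * x ^ (p - j) * R (b j))" .
  \<comment> \<open>By Fermat every nonzero m contributes 1, so the sum just counts them.\<close>
  have "(\<Sum>m<a. of_nat m ^ Suc q :: 'p mod_ring) = (\<Sum>m\<in>{1..<a}. 1)"
  proof (rule sum.mono_neutral_cong_right)
    show "\<forall>i\<in>{..<a} - {1..<a}. of_nat i ^ Suc q = (0 :: 'p mod_ring)" by (auto simp: not_le)
    fix m assume m: "m \<in> {1..<a}"
    hence "\<not> int p dvd int m" using a_less nat_dvd_not_less[of m p] by auto
    hence "(of_int (int m) :: 'p mod_ring) \<noteq> 0"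
      unfolding of_int_mod_ring_eq_0_iff p .
    thus "of_nat m ^ Suc q = (1 :: 'p mod_ring)"
      using fermat_mod_ring[OF p, of "of_nat m", unfolded pq(1)] by simp
  qed auto
  hence sum1: "(\<Sum>m<a. of_nat m ^ Suc q :: 'p mod_ring) = x - 1"
    using a_pos by (simp add: ax of_nat_diff)
  have q0: "q \<ge> 1" using assms(1) q by (cases q) auto
  have xq: "x ^ Suc q = 1" using fermat_mod_ring[OF p assms(2), unfolded pq(1)] .
  have "poly Psi x = (\<Sum>i = 1..q. R (b (Suc q - i)) * x ^ i)"
    unfolding Psi_def p[symmetric] pq by (simp add: poly_sum poly_monom R_def b_def)
  also have "\<dots> = (\<Sum>j = 1..q. R (b j) * x ^ (Suc q - j))"
    by (subst sum.atLeastAtMost_rev) (auto intro!: sum.cong)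
  finally have Psi: "poly Psi x = (\<Sum>j = 1..q. R (b j) * x ^ (Suc q - j))" .
  \<comment> \<open>The binomial coefficient is (-1)^(j-1). Even j has the sign wanted, and odd j >
    1 gives zero. Only j = 1 has the wrong sign, and since 2 B_1 = -1 the repair costs x^(p-1) =
    1.\<close>
  have "(\<Sum>j = 1..q. of_nat (Suc q choose (j - 1)) * x ^ (p - j) * R (b j))
    = (\<Sum>j = 1..q. - (x * (R (b j) * x ^ (Suc q - j))) - (if j = 1 then x ^ Suc q else 0))"
  proof (intro sum.cong refl)
    fix j assume j: "j \<in> {1..q}"
    have sgn: "of_nat (Suc q choose (j - 1)) = (- 1 :: 'p mod_ring) ^ (j - 1)"
      using j by (intro binomial_pred_prime[unfolded pq(1)]) (auto simp: q)
    have e: "x ^ (p - j) = x * x ^ (Suc q - j)"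
      using j by (simp add: q Suc_diff_le)
    consider "j = 1" | "even j" | "odd j" "j \<noteq> 1" by blast
    thus "of_nat (Suc q choose (j - 1)) * x ^ (p - j) * R (b j) =
      - (x * (R (b j) * x ^ (Suc q - j))) - (if j = 1 then x ^ Suc q else 0)"
    proof cases
      case 1
      have "R (b 1) = - 1 - R (b 1)"
        using rat_residue_bernoulli_1[OF assms(1)] by (simp add: R_def b_def eq_diff_eq)
      from arg_cong[OF this, of "\<lambda>y. x ^ Suc q * y"] 1 show ?thesis
        unfolding sgn by (simp add: e algebra_simps q)
    next
      case 2
      hence "odd (j - 1)" using j by simp
      with 2 show ?thesis unfolding sgn by (auto simp: e)
    next
      case 3
      hence "b j = 0" by (simp add: b_def bernoulli_odd)
      thus ?thesis using 3(2) rat_residue_of_int[OF p, of 0] by (simp add: R_def)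
    qed
  qed
  also have "\<dots> = - (x * poly Psi x) - 1"
    using q0 by (simp add: Psi sum_subtractf sum_negf sum_distrib_left sum.delta xq del: power_Suc)
  finally have "x - 1 - x * of_int f = x * (R c + 1) + (- (x * poly Psi x) - 1)"
    using * unfolding sum1 by simp
  moreover have "y = u - 1 - v" if "v = u + (- y - 1)" for u v y :: "'p mod_ring"
    unfolding that by simp
  ultimately have "x * poly Psi x = x * (R c + 1) - 1 - (x - 1 - x * of_int f)" by blast
  also have "\<dots> = x * (of_int f + R c)" by (simp add: algebra_simps)
  finally have "x * poly Psi x = x * (of_int f + R c)" .
  thus ?thesis using assms(2) by (simp add: f_def a R_def c_def)
qed

section \<open>The value of \<Psi> at 1\<close>

lemma sum_poly_Psi: "(\<Sum>x\<in>- {0 :: 'p mod_ring}. poly Psi x) = 0"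
proof -
  have "(\<Sum>x\<in>- {0 :: 'p mod_ring}. poly Psi x) =
    (\<Sum>i = 1..p - 2. \<Sum>x\<in>- {0}. rat_residue (bernoulli (p - 1 - i) / of_nat (p - 1 - i)) * x ^ i)"
    unfolding Psi_def p[symmetric] by (subst sum.swap) (simp add: poly_sum poly_monom)
  also have "\<dots> = 0"
  proof (rule sum.neutral, rule ballI)
    fix i assume "i \<in> {1..p - 2}"
    thus "(\<Sum>x\<in>- {0 :: 'p mod_ring}.
        rat_residue (bernoulli (p - 1 - i) / of_nat (p - 1 - i)) * x ^ i) = 0"
      unfolding sum_distrib_left[symmetric] by (subst sum_power_mod_ring[OF p]) auto
  qed
  finally show ?thesis .
qed

lemma poly_Psi_1:
  assumes "odd p"
  shows "poly Psi 1 = (rat_residue (bernoulli (p - 1) + 1 / of_nat p - 1) :: 'p mod_ring)"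
  using poly_Psi[OF assms, of 1] by simp

lemma wilson_quotient_residue:
  assumes "odd p"
  shows "p_integral p (wilson_quotient p)"
    and "poly Psi 1 = (rat_residue (wilson_quotient p) :: 'p mod_ring)"
proof -
  obtain w where w: "fact (p - 1) = int p * w - 1"
    and sum_w: "(\<Sum>x\<in>- {0 :: 'p mod_ring}. of_int (fermat_quotient p (to_int_mod_ring x))) =
      (of_int w :: 'p mod_ring)"
    using sum_fermat_quotient_eq_wilson[OF p assms] .
  have p0: "p > 0" using prime_gt_0_nat[OF prime_p[OF p]] .
  have "(fact (p - 1) :: rat) = of_int (int p * w - 1)"
    unfolding w[symmetric] by simp
  hence wq: "wilson_quotient p = of_int w"
    using p0 by (simp add: wilson_quotient_def)
  show "p_integral p (wilson_quotient p)"
    unfolding wq by (rule p_integral_of_int[OF p])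
  have card: "card (- {0 :: 'p mod_ring}) = p - 1"
    by (simp add: Compl_eq_Diff_UNIV card_Diff_singleton p)
  \<comment> \<open>Summing \<open>poly_Psi\<close> gives 0 = w + (p - 1) \<Psi>(1), and p - 1 is -1
    in the field.\<close>
  have "0 = (\<Sum>x\<in>- {0 :: 'p mod_ring}. poly Psi x)"
    by (simp only: sum_poly_Psi)
  also have "\<dots> = (\<Sum>x\<in>- {0 :: 'p mod_ring}. of_int (fermat_quotient p (to_int_mod_ring x)) + poly Psi 1)"
    unfolding poly_Psi_1[OF assms] by (intro sum.cong refl poly_Psi assms) auto
  also have "\<dots> = of_int w + of_nat (p - 1) * poly Psi 1"
    by (simp add: sum.distrib sum_w card)
  also have "of_nat (p - 1) = (- 1 :: 'p mod_ring)"
    using p0 of_nat_p[OF p] by (simp add: of_nat_diff)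
  finally show "poly Psi 1 = (rat_residue (wilson_quotient p) :: 'p mod_ring)"
    by (simp add: wq rat_residue_of_int[OF p])
qed

section \<open>The second form of \<Psi> and the minimal expression of the digit\<close>

lemma Psi_even_terms:
  assumes "odd p"
  shows "(Psi :: 'p mod_ring poly) =
     (\<Sum>i = 1..(p - 3) div 2.
        monom (rat_residue (bernoulli (p - 1 - 2 * i) / of_nat (p - 1 - 2 * i))) (2 * i))
     + monom (of_nat ((p - 1) div 2)) (p - 2)"
proof -
  have "p \<noteq> 1" using prime_p[OF p] by auto
  define h where "h = (p - 3) div 2"
  have h: "p = 2 * h + 3"
    using assms \<open>p \<noteq> 1\<close> unfolding h_def by presburger
  define g :: "nat \<Rightarrow> 'p mod_ring poly" where
    "g i = monom (rat_residue (bernoulli (p - 1 - i) / of_nat (p - 1 - i))) i" for i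
  \<comment> \<open>For odd i the Bernoulli index p - 1 - i is odd; it equals 1 only at i = p - 2 =
    2 h + 1, just outside this range.\<close>
  have g_odd: "g i = 0" if "odd i" "i \<le> 2 * h" for i
  proof -
    have "odd (p - 1 - i)" "p - 1 - i \<noteq> 1" using that by (auto simp: h)
    thus ?thesis using rat_residue_of_int[OF p, of 0] by (simp add: g_def bernoulli_odd)
  qed
  have "Psi = (\<Sum>i = 1..2 * h. g i) + g (p - 2)"
    unfolding Psi_def p[symmetric] g_def[symmetric] by (simp add: h)
  also have "(\<Sum>i = 1..2 * h. g i) = (\<Sum>i\<in>(*) 2 ` {1..h}. g i)"
  proof (rule sum.mono_neutral_right)
    show "\<forall>i\<in>{1..2 * h} - (*) 2 ` {1..h}. g i = 0"
    proof
      fix i assume i: "i \<in> {1..2 * h} - (*) 2 ` {1..h}"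
      hence "odd i" by (auto elim!: evenE)
      thus "g i = 0" using i by (intro g_odd) auto
    qed
  qed auto
  also have "\<dots> = (\<Sum>i = 1..h. g (2 * i))"
    by (subst sum.reindex) (auto simp: inj_on_def)
  also have "g (p - 2) = monom (of_nat ((p - 1) div 2)) (p - 2)"
  proof -
    \<comment> \<open>Here h + 1 is (p - 1) / 2; it agrees with B_1 = -1/2 in the field because both
      doubles are -1.\<close>
    have "2 * of_nat (h + 1) = (of_nat p - 1 :: 'p mod_ring)"
      by (simp add: h algebra_simps)
    also have "\<dots> = 2 * rat_residue (bernoulli 1 / of_nat 1)"
      using rat_residue_bernoulli_1[OF assms] by (simp add: of_nat_p[OF p])
    finally have "2 * of_nat (h + 1) = (2 * rat_residue (bernoulli 1 / of_nat 1) :: 'p mod_ring)" .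
    moreover have "(2 :: 'p mod_ring) \<noteq> 0"
      using coprime_imp_of_int_neq_0(1)[OF p, of 2] assms by simp
    ultimately have "of_nat (h + 1) = (rat_residue (bernoulli 1 / of_nat 1) :: 'p mod_ring)"
      by (metis mult_left_cancel)
    thus ?thesis by (simp add: g_def h)
  qed
  finally show ?thesis by (simp add: g_def h)
qed

lemma degree_Psi: "degree (Psi :: 'p mod_ring poly) \<le> p - 2"
  unfolding Psi_def p[symmetric]
  by (intro degree_sum_le) (auto intro: order.trans[OF degree_monom_le])

lemma minimal_polynomial_expression_digit_1:
  assumes "odd p"
  shows "minimal_polynomial_expression (digit_fun 1 :: ('n::finite \<Rightarrow> 'p mod_ring) \<Rightarrow> 'p mod_ring) =
       (\<Prod>j\<in>UNIV. MVar j) *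
         (subst_poly Psi (\<Prod>j\<in>UNIV. MVar j) - (\<Sum>j\<in>UNIV. subst_poly Psi (MVar j))
           + of_nat (CARD('n) - 1) * MConst (poly Psi 1))"
    (is "_ = ?X * ?S")
proof (rule minimal_polynomial_expression_eqI)
  fix x :: "'n \<Rightarrow> 'p mod_ring"
  define X where "X = (\<Prod>j\<in>UNIV. x j)"
  have ev: "meval (?X * ?S) x =
    X * (poly Psi X - (\<Sum>j\<in>UNIV. poly Psi (x j)) + of_nat (CARD('n) - 1) * poly Psi 1)"
    by (simp add: X_def)
  show "meval (?X * ?S) x = digit_fun 1 x"
  proof (cases "\<forall>j. x j \<noteq> 0")
    case True
    note F = poly_Psi[OF assms, folded poly_Psi_1[OF assms]]
    have "X \<noteq> 0" using True by (simp add: X_def)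
    hence "poly Psi X = of_int (fermat_quotient p (to_int_mod_ring X)) + poly Psi 1"
      by (rule F)
    moreover have "(\<Sum>j\<in>UNIV. poly Psi (x j)) =
        (\<Sum>j\<in>UNIV. of_int (fermat_quotient p (to_int_mod_ring (x j))) + poly Psi 1)"
      using True by (intro sum.cong refl F) simp
    \<comment> \<open>The multiples of \<Psi>(1) cancel: 1 - n + (n - 1) = 0, where n is at least
      1.\<close>
    ultimately have "poly Psi X - (\<Sum>j\<in>UNIV. poly Psi (x j)) + of_nat (CARD('n) - 1) * poly Psi 1 =
      of_int (fermat_quotient p (to_int_mod_ring X))
        - (\<Sum>j\<in>UNIV. of_int (fermat_quotient p (to_int_mod_ring (x j))))"
      by (simp add: sum.distrib of_nat_diff algebra_simps)
    thus ?thesis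
      unfolding ev using digit_1_eq_fermat_quotient[OF p, of x] True by (simp add: X_def)
  next
    case False
    \<comment> \<open>A zero coordinate makes the prefactor and the integer product vanish, so both
      sides are 0.\<close>
    hence zero: "X = 0" "(\<Prod>j\<in>UNIV. to_int_mod_ring (x j)) = 0"
      by (auto simp: X_def)
    show ?thesis unfolding ev digit_fun_def zero by simp
  qed
next
  have "max_degree_le (p - 2) (of_nat k * MConst c :: ('n, 'p mod_ring) mpoly)" for k c
    using max_degree_le_mult[OF max_degree_le_of_nat[of 0] max_degree_le_MConst] by simp
  \<comment> \<open>The prefactor uses one degree in each variable, and the bracket at most the p -
    2 of \<Psi>.\<close>
  hence "max_degree_le (1 + (p - 2)) (?X * ?S)"
    by (intro max_degree_le_mult max_degree_le_add max_degree_le_diff max_degree_le_sum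
          max_degree_le_prod_MVar max_degree_le_subst_poly max_degree_le_MVar degree_Psi)
  moreover have "CARD('p) - 1 = 1 + (p - 2)"
    using prime_ge_2_nat[OF prime_p[OF p]] by (simp add: p[symmetric])
  ultimately show "max_degree_le (CARD('p) - 1) (?X * ?S)" by (simp only:)
qed

end

theorem theorem2:
  fixes p n :: nat
  assumes p: "p = CARD('p::prime_card)" "odd p"
    and n: "n = CARD('n::finite)"
  shows
    "minimal_polynomial_expression (digit_fun 1 :: ('n \<Rightarrow> 'p mod_ring) \<Rightarrow> 'p mod_ring) =
       (\<Prod>j\<in>UNIV. MVar j) *
         (subst_poly Psi (\<Prod>j\<in>UNIV. MVar j) - (\<Sum>j\<in>UNIV. subst_poly Psi (MVar j))
           + of_nat (n - 1) * MConst (poly Psi 1))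
     \<and> (\<forall>i\<in>{1..p - 2}. p_integral p (bernoulli (p - 1 - i) / of_nat (p - 1 - i)))
     \<and> (Psi :: 'p mod_ring poly) =
         (\<Sum>i = 1..(p - 3) div 2.
            monom (rat_residue (bernoulli (p - 1 - 2 * i) / of_nat (p - 1 - 2 * i))) (2 * i))
         + monom (of_nat ((p - 1) div 2)) (p - 2)
     \<and> p_integral p (wilson_quotient p)
     \<and> poly Psi 1 = (rat_residue (wilson_quotient p) :: 'p mod_ring)
     \<and> p_integral p (bernoulli (p - 1) + 1 / of_nat p - 1)
     \<and> poly Psi 1 = (rat_residue (bernoulli (p - 1) + 1 / of_nat p - 1) :: 'p mod_ring)"
proof -
  \<comment> \<open>The reflection of i to p - 1 - i maps the range 1..p - 2 to itself.\<close>
  have "\<forall>i\<in>{1..p - 2}. p_integral p (bernoulli (p - 1 - i) / of_nat (p - 1 - i))"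
    by (intro ballI p_integral_bernoulli_div[OF p(1)]) auto
  thus ?thesis
    unfolding n
    by (intro conjI minimal_polynomial_expression_digit_1[OF p] Psi_even_terms[OF p]
        wilson_quotient_residue[OF p] p_integral_bernoulli_pred[OF p(1)] poly_Psi_1[OF p])
qed

end
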